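(* The class of all finite right restriction EI-Ehresmann semigroups is a pseudovariety of finite bi-unary semigroups (signature $(2,1,1)$ with operations $\cdot, {}^{+}, {}^{*}$), namely the one defined by the identities of Ehresmann semigroups, the right ample identity $b^{*}a=a(b^{*}a)^{*}$, and the profinite identity $$x^{\omega}(x^{\omega})^{+}=(x^{\omega})^{+}.$$
   Context: A subsemilattice $E$ of a semigroup $S$ is a commutative subsemigroup of idempotents. Define equivalences on $S$: $a\,\widetilde{\mathcal L}_E\, b$ iff for all $e\in E$ ($ae=a\Leftrightarrow be=b$); $a\,\widetilde{\mathcal R}_E\, b$ iff for all $e\in E$ ($ea=a\Leftrightarrow eb=b$); $\widetilde{\mathcal H}_E=\widetilde{\mathcal L}_E\cap\widetilde{\mathcal R}_E$. $S$ is ($E$-)Ehresmann if every $\widetilde{\mathcal L}_E$-class and every $\widetilde{\mathcal R}_E$-class contains a unique element of $E$ (denoted $a^{*}$, resp. $a^{+}$, for the class of $a$), $\widetilde{\mathcal L}_E$ is a right congruence and $\widetilde{\mathcal R}_E$ is a left congruence. Ehresmann semigroups are regarded as bi-unary semigroups $(S,\cdot,{}^{+},{}^{*})$, with $E=\{a^{*}\mid a\in S\}=\{a^{+}\mid a\in S\}$ the set of projections; as such they form a variety, and "the identities of Ehresmann semigroups" are the identities axiomatizing it, for example: associativity; $x^{+}x=x$, $x^{+}y^{+}=y^{+}x^{+}$, $(x^{+}y^{+})^{+}=x^{+}y^{+}$, $(xy)^{+}=(xy^{+})^{+}$; dually $xx^{*}=x$, $x^{*}y^{*}=y^{*}x^{*}$,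 $(x^{*}y^{*})^{*}=x^{*}y^{*}$, $(xy)^{*}=(x^{*}y)^{*}$; and $(x^{+})^{*}=x^{+}$, $(x^{*})^{+}=x^{*}$. An Ehresmann semigroup is right restriction if $ea=a(ea)^{*}$ for all $a\in S$, $e\in E$. The category $\mathbf C(S)$ associated with $S$ has object set $E$ and one morphism $C(a)$ for each $a\in S$, with domain $a^{*}$ and range $a^{+}$, and $C(b)C(a)=C(ba)$ when the range of $C(a)$ equals the domain of $C(b)$. $S$ is EI-Ehresmann if $\mathbf C(S)$ is an EI-category, i.e. every endomorphism is an isomorphism; equivalently, the $\widetilde{\mathcal H}_E$-class of every $e\in E$ is a group. A pseudovariety is a class of finite algebras (of a given signature) closed under subalgebras, homomorphic images and finite direct products. For an element $x$ of a finite semigroup, $x^{\omega}$ denotes the unique idempotent in the subsemigroup generated by $x$; a finite semigroup satisfies the profinite identity if it holds for all of its elements $x$. *)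

theory Defs
  imports "HOL-Library.FuncSet"
begin

record 'a biunary =
  carrier :: "'a set"
  mult :: "'a \<Rightarrow> 'a \<Rightarrow> 'a" (infixl "\<cdot>\<index>" 70)
  plus_op :: "'a \<Rightarrow> 'a"
  star_op :: "'a \<Rightarrow> 'a"

text \<open>Algebras are non-empty; the operations are only constrained on the carrier.\<close>

definition biunary_algebra :: "'a biunary \<Rightarrow> bool" where
  "biunary_algebra S \<longleftrightarrow>
     carrier S \<noteq> {} \<and>
     (\<forall>a\<in>carrier S. \<forall>b\<in>carrier S. a \<cdot>\<^bsub>S\<^esub> b \<in> carrier S) \<and>
     (\<forall>a\<in>carrier S. plus_op S a \<in> carrier S) \<and>
     (\<forall>a\<in>carrier S. star_op S a \<in> carrier S)"

definition finite_algebra :: "'a biunary \<Rightarrow> bool" where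
  "finite_algebra S \<longleftrightarrow> biunary_algebra S \<and> finite (carrier S)"

definition biunary_semigroup :: "'a biunary \<Rightarrow> bool" where
  "biunary_semigroup S \<longleftrightarrow>
     biunary_algebra S \<and>
     (\<forall>a\<in>carrier S. \<forall>b\<in>carrier S. \<forall>c\<in>carrier S.
        (a \<cdot>\<^bsub>S\<^esub> b) \<cdot>\<^bsub>S\<^esub> c = a \<cdot>\<^bsub>S\<^esub> (b \<cdot>\<^bsub>S\<^esub> c))"

definition subsemigroup :: "'a biunary \<Rightarrow> 'a set \<Rightarrow> bool" where
  "subsemigroup S T \<longleftrightarrow> T \<subseteq> carrier S \<and> (\<forall>a\<in>T. \<forall>b\<in>T. a \<cdot>\<^bsub>S\<^esub> b \<in> T)"

definition subsemilattice :: "'a biunary \<Rightarrow> 'a set \<Rightarrow> bool" where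
  "subsemilattice S E \<longleftrightarrow>
     subsemigroup S E \<and>
     (\<forall>e\<in>E. e \<cdot>\<^bsub>S\<^esub> e = e) \<and>
     (\<forall>e\<in>E. \<forall>f\<in>E. e \<cdot>\<^bsub>S\<^esub> f = f \<cdot>\<^bsub>S\<^esub> e)"

definition L_tilde :: "'a biunary \<Rightarrow> 'a set \<Rightarrow> 'a \<Rightarrow> 'a \<Rightarrow> bool" where
  "L_tilde S E a b \<longleftrightarrow> (\<forall>e\<in>E. a \<cdot>\<^bsub>S\<^esub> e = a \<longleftrightarrow> b \<cdot>\<^bsub>S\<^esub> e = b)"

definition R_tilde :: "'a biunary \<Rightarrow> 'a set \<Rightarrow> 'a \<Rightarrow> 'a \<Rightarrow> bool" where
  "R_tilde S E a b \<longleftrightarrow> (\<forall>e\<in>E. e \<cdot>\<^bsub>S\<^esub> a = a \<longleftrightarrow> e \<cdot>\<^bsub>S\<^esub> b = b)"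

text \<open>The unary operations play no role in the next definition, only in the one after it.\<close>

definition E_Ehresmann :: "'a biunary \<Rightarrow> 'a set \<Rightarrow> bool" where
  "E_Ehresmann S E \<longleftrightarrow>
     subsemilattice S E \<and>
     (\<forall>a\<in>carrier S. \<exists>!e. e \<in> E \<and> L_tilde S E a e) \<and>
     (\<forall>a\<in>carrier S. \<exists>!e. e \<in> E \<and> R_tilde S E a e) \<and>
     (\<forall>a\<in>carrier S. \<forall>b\<in>carrier S. \<forall>c\<in>carrier S.
        L_tilde S E a b \<longrightarrow> L_tilde S E (a \<cdot>\<^bsub>S\<^esub> c) (b \<cdot>\<^bsub>S\<^esub> c)) \<and>
     (\<forall>a\<in>carrier S. \<forall>b\<in>carrier S. \<forall>c\<in>carrier S.
        R_tilde S E a b \<longrightarrow> R_tilde S E (c \<cdot>\<^bsub>S\<^esub> a) (c \<cdot>\<^bsub>S\<^esub> b))"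

text \<open>
  An Ehresmann semigroup regarded as a bi-unary semigroup: the unary operations pick out the
  elements of \<open>E\<close> in the respective classes. The set \<open>E\<close> is then determined by the operations,
  see \<open>Ehresmann_projections\<close> below.
\<close>

definition Ehresmann :: "'a biunary \<Rightarrow> 'a set \<Rightarrow> bool" where
  "Ehresmann S E \<longleftrightarrow>
     biunary_semigroup S \<and> E_Ehresmann S E \<and>
     (\<forall>a\<in>carrier S. star_op S a \<in> E \<and> L_tilde S E a (star_op S a)) \<and>
     (\<forall>a\<in>carrier S. plus_op S a \<in> E \<and> R_tilde S E a (plus_op S a))"

lemma Ehresmann_projections:
  assumes "Ehresmann S E"
  shows "E = star_op S ` carrier S" and "E = plus_op S ` carrier S"
proof -
  have sub: "E \<subseteq> carrier S"
    using assms by (simp add: Ehresmann_def E_Ehresmann_def subsemilattice_def subsemigroup_def)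
  have L: "\<exists>!f. f \<in> E \<and> L_tilde S E e f" and R: "\<exists>!f. f \<in> E \<and> R_tilde S E e f"
    and s: "star_op S e \<in> E \<and> L_tilde S E e (star_op S e)"
    and p: "plus_op S e \<in> E \<and> R_tilde S E e (plus_op S e)" if "e \<in> carrier S" for e
    using assms that by (simp_all add: Ehresmann_def E_Ehresmann_def)
  have Lr: "L_tilde S E e e" and Rr: "R_tilde S E e e" for e
    by (simp_all add: L_tilde_def R_tilde_def)
  have "star_op S e = e" if "e \<in> E" for e
    using L[of e] s[of e] that sub Lr[of e] by blast
  then show "E = star_op S ` carrier S"
    using s sub by force
  have "plus_op S e = e" if "e \<in> E" for e
    using R[of e] p[of e] that sub Rr[of e] by blast
  then show "E = plus_op S ` carrier S"
    using p sub by force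
qed

definition right_restriction :: "'a biunary \<Rightarrow> 'a set \<Rightarrow> bool" where
  "right_restriction S E \<longleftrightarrow>
     Ehresmann S E \<and>
     (\<forall>a\<in>carrier S. \<forall>e\<in>E. e \<cdot>\<^bsub>S\<^esub> a = a \<cdot>\<^bsub>S\<^esub> star_op S (e \<cdot>\<^bsub>S\<^esub> a))"

text \<open>\<open>Comp C g f\<close> is ``\<open>g\<close> after \<open>f\<close>'' and is meaningful only if \<open>Cod C f = Dom C g\<close>.\<close>

record ('o, 'm) cat =
  Obj :: "'o set"
  Arr :: "'m set"
  Dom :: "'m \<Rightarrow> 'o"
  Cod :: "'m \<Rightarrow> 'o"
  Id :: "'o \<Rightarrow> 'm"
  Comp :: "'m \<Rightarrow> 'm \<Rightarrow> 'm"

definition category :: "('o, 'm) cat \<Rightarrow> bool" where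
  "category C \<longleftrightarrow>
     (\<forall>f\<in>Arr C. Dom C f \<in> Obj C \<and> Cod C f \<in> Obj C) \<and>
     (\<forall>x\<in>Obj C. Id C x \<in> Arr C \<and> Dom C (Id C x) = x \<and> Cod C (Id C x) = x) \<and>
     (\<forall>f\<in>Arr C. \<forall>g\<in>Arr C. Cod C f = Dom C g \<longrightarrow>
        Comp C g f \<in> Arr C \<and> Dom C (Comp C g f) = Dom C f \<and> Cod C (Comp C g f) = Cod C g) \<and>
     (\<forall>f\<in>Arr C. Comp C f (Id C (Dom C f)) = f \<and> Comp C (Id C (Cod C f)) f = f) \<and>
     (\<forall>f\<in>Arr C. \<forall>g\<in>Arr C. \<forall>h\<in>Arr C. Cod C f = Dom C g \<longrightarrow> Cod C g = Dom C h \<longrightarrow>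
        Comp C (Comp C h g) f = Comp C h (Comp C g f))"

definition isomorphism :: "('o, 'm) cat \<Rightarrow> 'm \<Rightarrow> bool" where
  "isomorphism C f \<longleftrightarrow>
     f \<in> Arr C \<and>
     (\<exists>g\<in>Arr C. Dom C g = Cod C f \<and> Cod C g = Dom C f \<and>
        Comp C g f = Id C (Dom C f) \<and> Comp C f g = Id C (Cod C f))"

definition EI_category :: "('o, 'm) cat \<Rightarrow> bool" where
  "EI_category C \<longleftrightarrow>
     category C \<and> (\<forall>f\<in>Arr C. Dom C f = Cod C f \<longrightarrow> isomorphism C f)"

text \<open>The morphism \<open>C(a)\<close> is represented by \<open>a\<close> itself.\<close>

definition category_of :: "'a biunary \<Rightarrow> 'a set \<Rightarrow> ('a, 'a) cat" where
  "category_of S E =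
     \<lparr>Obj = E, Arr = carrier S, Dom = star_op S, Cod = plus_op S,
      Id = (\<lambda>e. e), Comp = (\<lambda>b a. b \<cdot>\<^bsub>S\<^esub> a)\<rparr>"

definition EI_Ehresmann :: "'a biunary \<Rightarrow> 'a set \<Rightarrow> bool" where
  "EI_Ehresmann S E \<longleftrightarrow> Ehresmann S E \<and> EI_category (category_of S E)"

definition finite_right_restriction_EI_Ehresmann :: "'a biunary set" where
  "finite_right_restriction_EI_Ehresmann =
     {S. finite_algebra S \<and> (\<exists>E. right_restriction S E \<and> EI_Ehresmann S E)}"

definition hom :: "'a biunary \<Rightarrow> 'b biunary \<Rightarrow> ('a \<Rightarrow> 'b) \<Rightarrow> bool" where
  "hom S T h \<longleftrightarrow>
     h \<in> carrier S \<rightarrow> carrier T \<and>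
     (\<forall>a\<in>carrier S. \<forall>b\<in>carrier S. h (a \<cdot>\<^bsub>S\<^esub> b) = h a \<cdot>\<^bsub>T\<^esub> h b) \<and>
     (\<forall>a\<in>carrier S. h (plus_op S a) = plus_op T (h a)) \<and>
     (\<forall>a\<in>carrier S. h (star_op S a) = star_op T (h a))"

definition homomorphic_image :: "'a biunary \<Rightarrow> 'b biunary \<Rightarrow> bool" where
  "homomorphic_image S T \<longleftrightarrow> (\<exists>h. hom S T h \<and> h ` carrier S = carrier T)"

definition isomorphic :: "'a biunary \<Rightarrow> 'b biunary \<Rightarrow> bool" where
  "isomorphic S T \<longleftrightarrow> (\<exists>h. hom S T h \<and> bij_betw h (carrier S) (carrier T))"

definition subalgebra :: "'a biunary \<Rightarrow> 'a biunary \<Rightarrow> bool" where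
  "subalgebra T S \<longleftrightarrow>
     biunary_algebra T \<and> carrier T \<subseteq> carrier S \<and> hom T S (\<lambda>a. a)"

definition direct_product :: "'i set \<Rightarrow> ('i \<Rightarrow> 'a biunary) \<Rightarrow> ('i \<Rightarrow> 'a) biunary" where
  "direct_product I F =
     \<lparr>carrier = (\<Pi>\<^sub>E i\<in>I. carrier (F i)),
      mult = (\<lambda>f g. \<lambda>i\<in>I. f i \<cdot>\<^bsub>F i\<^esub> g i),
      plus_op = (\<lambda>f. \<lambda>i\<in>I. plus_op (F i) (f i)),
      star_op = (\<lambda>f. \<lambda>i\<in>I. star_op (F i) (f i))\<rparr>"

text \<open>
  A class of finite algebras is represented by the set of its members whose elements are drawn
  from \<open>'a\<close>. If \<open>'a\<close> is infinite (\<open>nat\<close>, say), every finite algebra has isomorphic copies there,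
  so this is the usual notion. Since a direct product of algebras over \<open>'a\<close> has elements of a
  different type, closure under products is closure under taking isomorphic copies over \<open>'a\<close> of
  products. The empty product (\<open>n = 0\<close>) is the trivial algebra.
\<close>

definition pseudovariety :: "'a biunary set \<Rightarrow> bool" where
  "pseudovariety K \<longleftrightarrow>
     (\<forall>S\<in>K. finite_algebra S) \<and>
     (\<forall>S\<in>K. \<forall>T :: 'a biunary. subalgebra T S \<longrightarrow> T \<in> K) \<and>
     (\<forall>S\<in>K. \<forall>T :: 'a biunary. homomorphic_image S T \<longrightarrow> T \<in> K) \<and>
     (\<forall>(n :: nat) F. \<forall>P :: 'a biunary.
        (\<forall>i<n. F i \<in> K) \<longrightarrow> biunary_algebra P \<longrightarrow> isomorphic P (direct_product {..<n} F) \<longrightarrow> P \<in> K)"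

definition Ehresmann_identities :: "'a biunary \<Rightarrow> bool" where
  "Ehresmann_identities S \<longleftrightarrow>
     (\<forall>x\<in>carrier S. \<forall>y\<in>carrier S. \<forall>z\<in>carrier S.
        (x \<cdot>\<^bsub>S\<^esub> y) \<cdot>\<^bsub>S\<^esub> z = x \<cdot>\<^bsub>S\<^esub> (y \<cdot>\<^bsub>S\<^esub> z)) \<and>
     (\<forall>x\<in>carrier S. plus_op S x \<cdot>\<^bsub>S\<^esub> x = x) \<and>
     (\<forall>x\<in>carrier S. \<forall>y\<in>carrier S.
        plus_op S x \<cdot>\<^bsub>S\<^esub> plus_op S y = plus_op S y \<cdot>\<^bsub>S\<^esub> plus_op S x) \<and>
     (\<forall>x\<in>carrier S. \<forall>y\<in>carrier S.
        plus_op S (plus_op S x \<cdot>\<^bsub>S\<^esub> plus_op S y) = plus_op S x \<cdot>\<^bsub>S\<^esub> plus_op S y) \<and>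
     (\<forall>x\<in>carrier S. \<forall>y\<in>carrier S.
        plus_op S (x \<cdot>\<^bsub>S\<^esub> y) = plus_op S (x \<cdot>\<^bsub>S\<^esub> plus_op S y)) \<and>
     (\<forall>x\<in>carrier S. x \<cdot>\<^bsub>S\<^esub> star_op S x = x) \<and>
     (\<forall>x\<in>carrier S. \<forall>y\<in>carrier S.
        star_op S x \<cdot>\<^bsub>S\<^esub> star_op S y = star_op S y \<cdot>\<^bsub>S\<^esub> star_op S x) \<and>
     (\<forall>x\<in>carrier S. \<forall>y\<in>carrier S.
        star_op S (star_op S x \<cdot>\<^bsub>S\<^esub> star_op S y) = star_op S x \<cdot>\<^bsub>S\<^esub> star_op S y) \<and>
     (\<forall>x\<in>carrier S. \<forall>y\<in>carrier S.
        star_op S (x \<cdot>\<^bsub>S\<^esub> y) = star_op S (star_op S x \<cdot>\<^bsub>S\<^esub> y)) \<and>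
     (\<forall>x\<in>carrier S. star_op S (plus_op S x) = plus_op S x) \<and>
     (\<forall>x\<in>carrier S. plus_op S (star_op S x) = star_op S x)"

definition right_ample_identity :: "'a biunary \<Rightarrow> bool" where
  "right_ample_identity S \<longleftrightarrow>
     (\<forall>a\<in>carrier S. \<forall>b\<in>carrier S.
        star_op S b \<cdot>\<^bsub>S\<^esub> a = a \<cdot>\<^bsub>S\<^esub> star_op S (star_op S b \<cdot>\<^bsub>S\<^esub> a))"

definition generated_subsemigroup :: "'a biunary \<Rightarrow> 'a \<Rightarrow> 'a set" where
  "generated_subsemigroup S x = \<Inter>{T. subsemigroup S T \<and> x \<in> T}"

definition omega :: "'a biunary \<Rightarrow> 'a \<Rightarrow> 'a" where
  "omega S x = (THE e. e \<in> generated_subsemigroup S x \<and> e \<cdot>\<^bsub>S\<^esub> e = e)"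

definition omega_identity :: "'a biunary \<Rightarrow> bool" where
  "omega_identity S \<longleftrightarrow>
     (\<forall>x\<in>carrier S. omega S x \<cdot>\<^bsub>S\<^esub> plus_op S (omega S x) = plus_op S (omega S x))"

end

(*
  Projections are fixed by both unary operations, which gives the equivalence between the
  definition of Ehresmann semigroups by the relations L_tilde, R_tilde and the one by identities.

  In a right restriction semigroup let e be an idempotent, f = e+ and y = ef. Then y is idempotent
  with y+ = f and y* <= f. The ample condition yields y* y = y (y* y)* = y (yy)* = y, hence
  f = y+ <= y*, so that y is an idempotent endomorphism of f in the associated category; if that
  category is EI then y = f, which for e = x^omega is the omega identity. Conversely, if
  x* = x+ = f, then every power of x has both projections equal to f, and the omega identity forces
  x^omega = f, so that a power of x is an inverse of x.

  The three closure properties follow because homomorphisms of finite algebras commute with omega.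
*)
theory Submission
  imports Defs
begin

section \<open>Ehresmann semigroups and their identities\<close>

text \<open>The equational side. \<open>Ehresmann_imp_ehresmann_algebra\<close> makes it available
  from the relational definition as well.\<close>

locale ehresmann_algebra =
  fixes S :: "'a biunary" (structure)
  assumes algebra: "biunary_algebra S"
    and identities: "Ehresmann_identities S"
begin

lemma mult_closed [simp, intro]: "x \<in> carrier S \<Longrightarrow> y \<in> carrier S \<Longrightarrow> x \<cdot> y \<in> carrier S"
  and plus_closed [simp, intro]: "x \<in> carrier S \<Longrightarrow> plus_op S x \<in> carrier S"
  and star_closed [simp, intro]: "x \<in> carrier S \<Longrightarrow> star_op S x \<in> carrier S"
  using algebra by (simp_all add: biunary_algebra_def)

lemma assoc:
  "x \<in> carrier S \<Longrightarrow> y \<in> carrier S \<Longrightarrow> z \<in> carrier S \<Longrightarrow> (x \<cdot> y) \<cdot> z = x \<cdot> (y \<cdot> z)"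
  and plus_mult_self: "x \<in> carrier S \<Longrightarrow> plus_op S x \<cdot> x = x"
  and plus_commute: "x \<in> carrier S \<Longrightarrow> y \<in> carrier S \<Longrightarrow>
    plus_op S x \<cdot> plus_op S y = plus_op S y \<cdot> plus_op S x"
  and plus_mult_plus: "x \<in> carrier S \<Longrightarrow> y \<in> carrier S \<Longrightarrow>
    plus_op S (plus_op S x \<cdot> plus_op S y) = plus_op S x \<cdot> plus_op S y"
  and plus_mult: "x \<in> carrier S \<Longrightarrow> y \<in> carrier S \<Longrightarrow>
    plus_op S (x \<cdot> y) = plus_op S (x \<cdot> plus_op S y)"
  and mult_star_self: "x \<in> carrier S \<Longrightarrow> x \<cdot> star_op S x = x"
  and star_commute: "x \<in> carrier S \<Longrightarrow> y \<in> carrier S \<Longrightarrow>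
    star_op S x \<cdot> star_op S y = star_op S y \<cdot> star_op S x"
  and star_mult_star: "x \<in> carrier S \<Longrightarrow> y \<in> carrier S \<Longrightarrow>
    star_op S (star_op S x \<cdot> star_op S y) = star_op S x \<cdot> star_op S y"
  and star_mult: "x \<in> carrier S \<Longrightarrow> y \<in> carrier S \<Longrightarrow>
    star_op S (x \<cdot> y) = star_op S (star_op S x \<cdot> y)"
  and star_plus: "x \<in> carrier S \<Longrightarrow> star_op S (plus_op S x) = plus_op S x"
  and plus_star: "x \<in> carrier S \<Longrightarrow> plus_op S (star_op S x) = star_op S x"
  using identities unfolding Ehresmann_identities_def by blast+

lemma semigroup: "biunary_semigroup S"
  by (simp add: biunary_semigroup_def algebra assoc)

text \<open>The image of \<open>plus_op S\<close> is the same set, by \<open>star_plus\<close> and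
  \<open>plus_star\<close>.\<close>

definition projections :: "'a set" where
  "projections = star_op S ` carrier S"

lemma projections_closed: "e \<in> projections \<Longrightarrow> e \<in> carrier S"
  by (auto simp: projections_def)

lemma star_in_projections: "x \<in> carrier S \<Longrightarrow> star_op S x \<in> projections"
  by (simp add: projections_def)

lemma plus_in_projections: "x \<in> carrier S \<Longrightarrow> plus_op S x \<in> projections"
  by (metis plus_closed star_in_projections star_plus)

lemma plus_projection: "e \<in> projections \<Longrightarrow> plus_op S e = e"
  by (auto simp: projections_def plus_star)

lemma star_projection: "e \<in> projections \<Longrightarrow> star_op S e = e"
  by (metis plus_projection projections_closed star_plus)

lemma projection_idem: "e \<in> projections \<Longrightarrow> e \<cdot> e = e"
  by (metis mult_star_self projections_closed star_projection)

lemma projection_commute: "e \<in> projections \<Longrightarrow> f \<in> projections \<Longrightarrow> e \<cdot> f = f \<cdot> e"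
  by (metis projections_closed star_commute star_projection)

lemma projection_mult: "e \<in> projections \<Longrightarrow> f \<in> projections \<Longrightarrow> e \<cdot> f \<in> projections"
  by (metis mult_closed projections_closed star_in_projections star_mult_star star_projection)

text \<open>In the order of the semilattice this makes \<open>star_op S x\<close> the least
  projection fixing \<open>x\<close> on the right. Forwards, take stars in
  \<open>x \<cdot> e = x\<close>; backwards, multiply by \<open>x\<close> on the left.\<close>

lemma mult_projection_iff:
  assumes "x \<in> carrier S" and "e \<in> projections"
  shows "x \<cdot> e = x \<longleftrightarrow> star_op S x \<cdot> e = star_op S x"
proof
  assume "x \<cdot> e = x"
  then have "star_op S x = star_op S (star_op S x \<cdot> e)"
    using assms by (metis projections_closed star_mult)
  also have "\<dots> = star_op S x \<cdot> e"
    using assms by (simp add: projection_mult star_in_projections star_projection)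
  finally show "star_op S x \<cdot> e = star_op S x" ..
next
  assume "star_op S x \<cdot> e = star_op S x"
  then show "x \<cdot> e = x"
    using assms by (metis assoc mult_star_self projections_closed star_closed)
qed

lemma projection_mult_iff:
  assumes "x \<in> carrier S" and "e \<in> projections"
  shows "e \<cdot> x = x \<longleftrightarrow> e \<cdot> plus_op S x = plus_op S x"
proof
  assume "e \<cdot> x = x"
  then have "plus_op S x = plus_op S (e \<cdot> plus_op S x)"
    using assms by (metis projections_closed plus_mult)
  also have "\<dots> = e \<cdot> plus_op S x"
    using assms by (simp add: projection_mult plus_in_projections plus_projection)
  finally show "e \<cdot> plus_op S x = plus_op S x" ..
next
  assume "e \<cdot> plus_op S x = plus_op S x"
  then show "e \<cdot> x = x"
    using assms by (metis assoc plus_mult_self projections_closed plus_closed)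
qed

lemma L_tilde_star: "x \<in> carrier S \<Longrightarrow> L_tilde S projections x (star_op S x)"
  by (simp add: L_tilde_def mult_projection_iff)

lemma R_tilde_plus: "x \<in> carrier S \<Longrightarrow> R_tilde S projections x (plus_op S x)"
  by (simp add: R_tilde_def projection_mult_iff)

text \<open>Testing the relation at the two stars puts each below the other.\<close>

lemma L_tilde_iff:
  assumes "x \<in> carrier S" and "y \<in> carrier S"
  shows "L_tilde S projections x y \<longleftrightarrow> star_op S x = star_op S y"
proof
  assume "L_tilde S projections x y"
  then have "star_op S y \<cdot> star_op S x = star_op S y" "star_op S x \<cdot> star_op S y = star_op S x"
    using assms by (metis L_tilde_def mult_projection_iff mult_star_self star_in_projections)+
  then show "star_op S x = star_op S y"
    using assms by (metis star_commute)
qed (use assms in \<open>simp add: L_tilde_def mult_projection_iff\<close>)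

lemma R_tilde_iff:
  assumes "x \<in> carrier S" and "y \<in> carrier S"
  shows "R_tilde S projections x y \<longleftrightarrow> plus_op S x = plus_op S y"
proof
  assume "R_tilde S projections x y"
  then have "plus_op S y \<cdot> plus_op S x = plus_op S x" "plus_op S x \<cdot> plus_op S y = plus_op S y"
    using assms by (metis R_tilde_def projection_mult_iff plus_mult_self plus_in_projections)+
  then show "plus_op S x = plus_op S y"
    using assms by (metis plus_commute)
qed (use assms in \<open>simp add: R_tilde_def projection_mult_iff\<close>)

text \<open>Once the relations are equality of stars and of pluses, uniqueness holds because
  projections are fixed by both operations, and the congruence properties are
  \<open>star_mult\<close> and \<open>plus_mult\<close>.\<close>

lemma Ehresmann: "Ehresmann S projections"
proof -
  have "subsemilattice S projections"
    by (auto simp: subsemilattice_def subsemigroup_def projections_closed projection_mult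
        projection_idem intro: projection_commute)
  moreover have "\<exists>!e. e \<in> projections \<and> L_tilde S projections x e" if "x \<in> carrier S" for x
    by (metis L_tilde_iff projections_closed star_in_projections star_projection that)
  moreover have "\<exists>!e. e \<in> projections \<and> R_tilde S projections x e" if "x \<in> carrier S" for x
    by (metis R_tilde_iff projections_closed plus_in_projections plus_projection that)
  moreover have "L_tilde S projections (a \<cdot> c) (b \<cdot> c)"
    if "a \<in> carrier S" "b \<in> carrier S" "c \<in> carrier S" "L_tilde S projections a b" for a b c
    using that by (simp add: L_tilde_iff) (metis star_mult)
  moreover have "R_tilde S projections (c \<cdot> a) (c \<cdot> b)"
    if "a \<in> carrier S" "b \<in> carrier S" "c \<in> carrier S" "R_tilde S projections a b" for a b c
    using that by (simp add: R_tilde_iff) (metis plus_mult)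
  ultimately show ?thesis
    by (simp add: Ehresmann_def E_Ehresmann_def semigroup star_in_projections
        plus_in_projections L_tilde_star R_tilde_plus)
qed

text \<open>By \<open>star_mult\<close>, \<open>x\<close> may be replaced by its star, which is the
  plus of \<open>y\<close> and is absorbed by \<open>y\<close>.\<close>

lemma star_mult_composable:
  assumes "x \<in> carrier S" and "y \<in> carrier S" and "star_op S x = plus_op S y"
  shows "star_op S (x \<cdot> y) = star_op S y"
  using assms by (metis plus_mult_self star_mult)

lemma plus_mult_composable:
  assumes "x \<in> carrier S" and "y \<in> carrier S" and "star_op S x = plus_op S y"
  shows "plus_op S (x \<cdot> y) = plus_op S x"
  using assms by (metis mult_star_self plus_mult)

lemma category: "category (category_of S projections)"
  by (auto simp: category_def category_of_def star_in_projections plus_in_projections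
      projections_closed star_projection plus_projection star_mult_composable
      plus_mult_composable mult_star_self plus_mult_self assoc)

end

lemma Ehresmann_imp_ehresmann_algebra:
  assumes "Ehresmann S E"
  shows "ehresmann_algebra S"
proof
  have alg: "biunary_algebra S"
    and assoc: "\<And>x y z. x \<in> carrier S \<Longrightarrow> y \<in> carrier S \<Longrightarrow> z \<in> carrier S \<Longrightarrow>
      (x \<cdot>\<^bsub>S\<^esub> y) \<cdot>\<^bsub>S\<^esub> z = x \<cdot>\<^bsub>S\<^esub> (y \<cdot>\<^bsub>S\<^esub> z)"
    using assms by (auto simp: Ehresmann_def biunary_semigroup_def)
  then have mult: "\<And>x y. x \<in> carrier S \<Longrightarrow> y \<in> carrier S \<Longrightarrow> x \<cdot>\<^bsub>S\<^esub> y \<in> carrier S"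
    by (simp add: biunary_algebra_def)
  have sub: "\<And>e. e \<in> E \<Longrightarrow> e \<in> carrier S"
    and closed: "\<And>e f. e \<in> E \<Longrightarrow> f \<in> E \<Longrightarrow> e \<cdot>\<^bsub>S\<^esub> f \<in> E"
    and idem: "\<And>e. e \<in> E \<Longrightarrow> e \<cdot>\<^bsub>S\<^esub> e = e"
    and comm: "\<And>e f. e \<in> E \<Longrightarrow> f \<in> E \<Longrightarrow> e \<cdot>\<^bsub>S\<^esub> f = f \<cdot>\<^bsub>S\<^esub> e"
    using assms
    by (auto simp: Ehresmann_def E_Ehresmann_def subsemilattice_def subsemigroup_def)
  have star: "\<And>x. x \<in> carrier S \<Longrightarrow> star_op S x \<in> E \<and> L_tilde S E x (star_op S x)"
    and plus: "\<And>x. x \<in> carrier S \<Longrightarrow> plus_op S x \<in> E \<and> R_tilde S E x (plus_op S x)"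
    using assms by (auto simp: Ehresmann_def)
  have L_unique: "star_op S x = e" if "x \<in> carrier S" "e \<in> E" "L_tilde S E x e" for x e
    using assms that star[of x] unfolding Ehresmann_def E_Ehresmann_def by blast
  have R_unique: "plus_op S x = e" if "x \<in> carrier S" "e \<in> E" "R_tilde S E x e" for x e
    using assms that plus[of x] unfolding Ehresmann_def E_Ehresmann_def by blast
  have L_cong: "L_tilde S E (x \<cdot>\<^bsub>S\<^esub> z) (y \<cdot>\<^bsub>S\<^esub> z)"
    if "x \<in> carrier S" "y \<in> carrier S" "z \<in> carrier S" "L_tilde S E x y" for x y z
    using assms that unfolding Ehresmann_def E_Ehresmann_def by blast
  have R_cong: "R_tilde S E (z \<cdot>\<^bsub>S\<^esub> x) (z \<cdot>\<^bsub>S\<^esub> y)"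
    if "x \<in> carrier S" "y \<in> carrier S" "z \<in> carrier S" "R_tilde S E x y" for x y z
    using assms that unfolding Ehresmann_def E_Ehresmann_def by blast
  \<comment> \<open>Both relations are reflexive, so an element of \<open>E\<close> is the chosen
    element of its own class.\<close>
  have star_E: "star_op S e = e" and plus_E: "plus_op S e = e" if "e \<in> E" for e
    using that sub by (simp_all add: L_unique R_unique L_tilde_def R_tilde_def)
  \<comment> \<open>The star of \<open>x\<close> fixes itself, being idempotent;
    \<open>L_tilde\<close> transfers this to \<open>x\<close>.\<close>
  have mult_star: "x \<cdot>\<^bsub>S\<^esub> star_op S x = x" and mult_plus: "plus_op S x \<cdot>\<^bsub>S\<^esub> x = x"
    if "x \<in> carrier S" for x
    using that star plus idem by (auto simp: L_tilde_def R_tilde_def)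
  have star_mult: "star_op S (x \<cdot>\<^bsub>S\<^esub> y) = star_op S (star_op S x \<cdot>\<^bsub>S\<^esub> y)"
    if x: "x \<in> carrier S" and y: "y \<in> carrier S" for x y
  proof (rule L_unique)
    \<comment> \<open>The right congruence applied to \<open>x\<close> and its star.\<close>
    have "L_tilde S E (x \<cdot>\<^bsub>S\<^esub> y) (star_op S x \<cdot>\<^bsub>S\<^esub> y)"
      using x y star sub by (intro L_cong) auto
    then show "L_tilde S E (x \<cdot>\<^bsub>S\<^esub> y) (star_op S (star_op S x \<cdot>\<^bsub>S\<^esub> y))"
      using x y star[of "star_op S x \<cdot>\<^bsub>S\<^esub> y"] star[OF x] sub mult by (auto simp: L_tilde_def)
  qed (use x y star sub mult in auto)
  have plus_mult: "plus_op S (x \<cdot>\<^bsub>S\<^esub> y) = plus_op S (x \<cdot>\<^bsub>S\<^esub> plus_op S y)"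
    if x: "x \<in> carrier S" and y: "y \<in> carrier S" for x y
  proof (rule R_unique)
    have "R_tilde S E (x \<cdot>\<^bsub>S\<^esub> y) (x \<cdot>\<^bsub>S\<^esub> plus_op S y)"
      using x y plus sub by (intro R_cong) auto
    then show "R_tilde S E (x \<cdot>\<^bsub>S\<^esub> y) (plus_op S (x \<cdot>\<^bsub>S\<^esub> plus_op S y))"
      using x y plus[of "x \<cdot>\<^bsub>S\<^esub> plus_op S y"] plus[OF y] sub mult by (auto simp: R_tilde_def)
  qed (use x y plus sub mult in auto)
  show "Ehresmann_identities S"
    unfolding Ehresmann_identities_def
    using assoc mult_star mult_plus star_mult plus_mult star plus
    by (intro conjI ballI) (auto simp: star_E plus_E closed intro: comm)
  show "biunary_algebra S" by (fact alg)
qed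

text \<open>Removes \<open>E\<close> as a parameter, so that an existential over \<open>E\<close>
  can be eliminated.\<close>

lemma Ehresmann_iff:
  "Ehresmann S E \<longleftrightarrow>
     biunary_algebra S \<and> Ehresmann_identities S \<and> E = star_op S ` carrier S"
proof
  assume E: "Ehresmann S E"
  then interpret ehresmann_algebra S by (rule Ehresmann_imp_ehresmann_algebra)
  show "biunary_algebra S \<and> Ehresmann_identities S \<and> E = star_op S ` carrier S"
    using Ehresmann_projections(1)[OF E] algebra identities by blast
next
  assume *: "biunary_algebra S \<and> Ehresmann_identities S \<and> E = star_op S ` carrier S"
  then interpret ehresmann_algebra S by unfold_locales auto
  show "Ehresmann S E"
    using Ehresmann * by (simp add: projections_def)
qed

text \<open>Every element of \<open>E\<close> is a star, so the condition over \<open>E\<close>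
  becomes an identity in two variables.\<close>

lemma right_restriction_iff:
  "right_restriction S E \<longleftrightarrow>
     biunary_algebra S \<and> Ehresmann_identities S \<and> right_ample_identity S \<and>
     E = star_op S ` carrier S"
  by (auto simp: right_restriction_def Ehresmann_iff right_ample_identity_def)

section \<open>Powers and the idempotent power\<close>

text \<open>Without an identity element exponents start at 1: \<open>spow S x n\<close> is the power
  \<open>x\<^sup>n\<^sup>+\<^sup>1\<close>.\<close>

primrec spow :: "'a biunary \<Rightarrow> 'a \<Rightarrow> nat \<Rightarrow> 'a" where
  "spow S x 0 = x"
| "spow S x (Suc n) = x \<cdot>\<^bsub>S\<^esub> spow S x n"

lemma spow_closed:
  assumes "biunary_algebra S" and "x \<in> carrier S"
  shows "spow S x n \<in> carrier S"
  using assms by (induction n) (auto simp: biunary_algebra_def)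

text \<open>The exponents \<open>m + 1\<close> and \<open>n + 1\<close> add up to
  \<open>m + n + 2\<close>, which has index \<open>Suc (m + n)\<close>.\<close>

lemma spow_mult:
  assumes S: "biunary_semigroup S" and x: "x \<in> carrier S"
  shows "spow S x m \<cdot>\<^bsub>S\<^esub> spow S x n = spow S x (Suc (m + n))"
proof (induction m)
  case (Suc m)
  have "\<And>k. spow S x k \<in> carrier S"
    using S x by (simp add: biunary_semigroup_def spow_closed)
  then have "spow S x (Suc m) \<cdot>\<^bsub>S\<^esub> spow S x n = x \<cdot>\<^bsub>S\<^esub> (spow S x m \<cdot>\<^bsub>S\<^esub> spow S x n)"
    using S x by (simp add: biunary_semigroup_def)
  with Suc show ?case by simp
qed simp

lemma generated_subsemigroup_eq:
  assumes S: "biunary_semigroup S" and x: "x \<in> carrier S"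
  shows "generated_subsemigroup S x = range (spow S x)"
proof
  have "subsemigroup S (range (spow S x))"
    using S x spow_closed[of S x] spow_mult[OF S x]
    by (auto simp: subsemigroup_def biunary_semigroup_def simp del: spow.simps)
  moreover have "x \<in> range (spow S x)"
    by (metis rangeI spow.simps(1))
  ultimately show "generated_subsemigroup S x \<subseteq> range (spow S x)"
    unfolding generated_subsemigroup_def by blast
  have "spow S x n \<in> T" if "subsemigroup S T" "x \<in> T" for T n
    using that by (induction n) (auto simp: subsemigroup_def)
  then show "range (spow S x) \<subseteq> generated_subsemigroup S x"
    unfolding generated_subsemigroup_def by blast
qed

text \<open>An idempotent equals all its powers, so both sides equal the power of \<open>x\<close>
  with exponent \<open>(m + 1) * (n + 1)\<close>.\<close>

lemma spow_idempotent_unique: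
  assumes S: "biunary_semigroup S" and x: "x \<in> carrier S"
    and m: "spow S x m \<cdot>\<^bsub>S\<^esub> spow S x m = spow S x m"
    and n: "spow S x n \<cdot>\<^bsub>S\<^esub> spow S x n = spow S x n"
  shows "spow S x m = spow S x n"
proof -
  \<comment> \<open>This index belongs to the power of \<open>spow S x i\<close> with exponent
    \<open>j + 1\<close>.\<close>
  have power: "spow S x (Suc j * Suc i - 1) = spow S x i"
    if "spow S x i \<cdot>\<^bsub>S\<^esub> spow S x i = spow S x i" for i j
  proof (induction j)
    case (Suc j)
    have "Suc (Suc j) * Suc i - 1 = Suc (i + (Suc j * Suc i - 1))" by simp
    then have "spow S x (Suc (Suc j) * Suc i - 1)
        = spow S x i \<cdot>\<^bsub>S\<^esub> spow S x (Suc j * Suc i - 1)"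
      by (metis S spow_mult x)
    also have "\<dots> = spow S x i" using Suc that by simp
    finally show ?case .
  qed simp
  show ?thesis
    using power[OF m, of n] power[OF n, of m] by (metis mult.commute)
qed

text \<open>By the pigeonhole principle the powers are eventually periodic; an exponent divisible by
  the period and large enough gives an idempotent.\<close>

lemma spow_idempotent_exists:
  assumes S: "biunary_semigroup S" and fin: "finite (carrier S)" and x: "x \<in> carrier S"
  shows "\<exists>n. spow S x n \<cdot>\<^bsub>S\<^esub> spow S x n = spow S x n"
proof -
  have "range (spow S x) \<subseteq> carrier S"
    using S x by (auto simp: biunary_semigroup_def spow_closed)
  then have "finite (range (spow S x))"
    using fin finite_subset by blast
  then have "\<not> inj (spow S x)"
    using finite_imageD by blast
  then obtain i j where ij: "i < j" "spow S x i = spow S x j"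
    by (metis injI linorder_neqE_nat)
  define p where "p = j - i"
  have p: "p > 0" and per: "spow S x (i + p) = spow S x i"
    using ij by (auto simp: p_def)
  \<comment> \<open>Multiplying by \<open>spow S x l\<close> shifts the index by
    \<open>Suc l\<close>, so a zero shift is a separate case.\<close>
  have per': "spow S x (i + k + p) = spow S x (i + k)" for k
  proof (cases k)
    case (Suc l)
    have "spow S x (i + k + p) = spow S x (i + p) \<cdot>\<^bsub>S\<^esub> spow S x l"
      using Suc by (simp add: spow_mult[OF S x] ac_simps)
    also have "\<dots> = spow S x (i + k)"
      using Suc by (simp add: per spow_mult[OF S x])
    finally show ?thesis .
  qed (simp add: per)
  have per'': "spow S x (i + k + q * p) = spow S x (i + k)" for k q
  proof (induction q)
    case (Suc q)
    then show ?case
      using per'[of "k + q * p"] by (simp add: ac_simps)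
  qed simp
  \<comment> \<open>\<open>spow S x n\<close> is the power with exponent \<open>Suc i * p\<close>, a multiple of the period beyond \<open>i\<close>.\<close>
  define n where "n = Suc i * p - 1"
  \<comment> \<open>The index \<open>n\<close> lies in the periodic range, and squaring shifts it by
    \<open>Suc i\<close> periods.\<close>
  have "n \<ge> i" "Suc (n + n) = n + Suc i * p"
  proof -
    have "Suc n = Suc i * p" "Suc i * 1 \<le> Suc i * p"
      using p by (auto simp: n_def simp del: mult_Suc)
    then show "n \<ge> i" "Suc (n + n) = n + Suc i * p" by simp_all
  qed
  then have "spow S x n \<cdot>\<^bsub>S\<^esub> spow S x n = spow S x n"
    using per''[of "n - i" "Suc i"] by (simp only: spow_mult[OF S x] le_add_diff_inverse)
  then show ?thesis ..
qed

text \<open>Uniqueness of the idempotent power evaluates the definite description: any idempotent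
  power found is the omega power.\<close>

lemma omega_eqI:
  assumes "biunary_semigroup S" and "x \<in> carrier S"
    and "spow S x n \<cdot>\<^bsub>S\<^esub> spow S x n = spow S x n"
  shows "omega S x = spow S x n"
  unfolding omega_def generated_subsemigroup_eq[OF assms(1,2)]
  using assms spow_idempotent_unique[OF assms(1,2)] by (intro the_equality) auto

lemma omega_spow:
  assumes "biunary_semigroup S" and "finite (carrier S)" and "x \<in> carrier S"
  obtains n where "omega S x = spow S x n" and "spow S x n \<cdot>\<^bsub>S\<^esub> spow S x n = spow S x n"
  using spow_idempotent_exists[OF assms] omega_eqI[OF assms(1,3)] by metis

lemma omega_closed:
  assumes "biunary_semigroup S" and "finite (carrier S)" and "x \<in> carrier S"
  shows "omega S x \<in> carrier S"
  using assms omega_spow[OF assms] spow_closed by (metis biunary_semigroup_def)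

section \<open>The EI condition and the omega identity\<close>

context ehresmann_algebra
begin

text \<open>Stated for any idempotent \<open>e\<close>. The element \<open>e \<cdot> f\<close> is
  shown to be an endomorphism, which makes the EI condition applicable.\<close>

lemma idempotent_mult_plus:
  assumes ample: "right_ample_identity S" and EI: "EI_category (category_of S projections)"
    and e: "e \<in> carrier S" and idem: "e \<cdot> e = e"
  shows "e \<cdot> plus_op S e = plus_op S e"
proof -
  define f y g where "f = plus_op S e" and "y = e \<cdot> f" and "g = star_op S y"
  have carr: "f \<in> carrier S" "y \<in> carrier S" "g \<in> carrier S"
    using e by (auto simp: f_def y_def g_def)
  have proj: "f \<in> projections" "g \<in> projections"
    using e carr by (auto simp: f_def g_def plus_in_projections star_in_projections)
  have fe: "f \<cdot> e = e"
    using e by (simp add: f_def plus_mult_self)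
  have yf: "y \<cdot> f = y"
    using e carr proj by (simp add: y_def assoc projection_idem)
  have yy: "y \<cdot> y = y"
    using e carr yf by (metis assoc fe idem mult_closed y_def)
  have plus_y: "plus_op S y = f"
    using e idem plus_mult[of e e] by (simp add: y_def f_def)
  \<comment> \<open>With this, the ample identity with both variables equal to \<open>y\<close>
    reads \<open>g \<cdot> y = y \<cdot> g\<close>.\<close>
  have "star_op S (g \<cdot> y) = g"
    using carr yy star_mult[of y y] by (simp add: g_def)
  then have "g \<cdot> y = y \<cdot> g"
    using ample carr by (metis g_def right_ample_identity_def)
  then have "g \<cdot> y = y"
    using carr by (simp add: g_def mult_star_self)
  \<comment> \<open>The order relations \<open>f \<le> g\<close>, from
    \<open>g \<cdot> y = y\<close>, and then \<open>g \<le> f\<close>, from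
    \<open>y \<cdot> f = y\<close>.\<close>
  then have "g \<cdot> f = f"
    using carr proj plus_y projection_mult_iff by blast
  moreover have "g \<cdot> f = g"
    using carr proj yf mult_projection_iff g_def by blast
  ultimately have "star_op S y = plus_op S y"
    by (simp add: plus_y flip: g_def)
  then have "isomorphism (category_of S projections) y"
    using EI carr by (simp add: EI_category_def category_of_def)
  then obtain z where "z \<in> carrier S" "y \<cdot> z = f"
    by (auto simp: isomorphism_def category_of_def plus_y)
  \<comment> \<open>An idempotent with a right inverse is an identity:
    \<open>y = y \<cdot> f = y \<cdot> y \<cdot> z = y \<cdot> z = f\<close>.\<close>
  then have "y = f"
    using carr yy yf by (metis assoc)
  then show ?thesis
    by (simp add: y_def f_def)
qed

lemma omega_identity_if_EI:
  assumes fin: "finite (carrier S)" and "right_ample_identity S"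
    and "EI_category (category_of S projections)"
  shows "omega_identity S"
  unfolding omega_identity_def
proof
  fix x assume x: "x \<in> carrier S"
  obtain n where "omega S x = spow S x n" "spow S x n \<cdot> spow S x n = spow S x n"
    using omega_spow[OF semigroup fin x] .
  then show "omega S x \<cdot> plus_op S (omega S x) = plus_op S (omega S x)"
    using idempotent_mult_plus[OF assms(2,3)] spow_closed[OF algebra x] by metis
qed

text \<open>Powers of an endomorphism are endomorphisms of the same object.\<close>

lemma projections_spow:
  assumes x: "x \<in> carrier S" and endo: "star_op S x = plus_op S x"
  shows "star_op S (spow S x n) = plus_op S x \<and> plus_op S (spow S x n) = plus_op S x"
proof (induction n)
  case (Suc n)
  then show ?case
    using x endo spow_closed[OF algebra x]
    by (simp add: star_mult_composable plus_mult_composable)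
qed (simp add: endo)

lemma EI_if_omega_identity:
  assumes fin: "finite (carrier S)" and omega: "omega_identity S"
  shows "EI_category (category_of S projections)"
proof -
  have "isomorphism (category_of S projections) x"
    if x: "x \<in> carrier S" and endo: "star_op S x = plus_op S x" for x
  proof -
    let ?f = "plus_op S x"
    note carr = spow_closed[OF algebra x]
    obtain n where n: "omega S x = spow S x n" "spow S x n \<cdot> spow S x n = spow S x n"
      using omega_spow[OF semigroup fin x] .
    have "spow S x n = spow S x n \<cdot> ?f"
      using carr projections_spow[OF x endo] mult_star_self by metis
    also have "\<dots> = ?f"
      using omega x n projections_spow[OF x endo] by (metis omega_identity_def)
    \<comment> \<open>Squaring the idempotent makes the index positive, so a factor \<open>x\<close>
      can be split off on either side even if \<open>n = 0\<close>; the remaining power is the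
      inverse.\<close>
    finally have f: "spow S x (Suc (n + n)) = ?f"
      using n spow_mult[OF semigroup x] by metis
    have "x \<cdot> spow S x (n + n) = ?f"
      using f by simp
    moreover have "spow S x (n + n) \<cdot> x = ?f"
      using f spow_mult[OF semigroup x, of "n + n" 0] by simp
    ultimately show ?thesis
      using x endo carr projections_spow[OF x endo]
      by (auto simp: isomorphism_def category_of_def)
  qed
  then show ?thesis
    using category by (simp add: EI_category_def category_of_def)
qed

end

text \<open>\<open>Ehresmann_iff\<close> forces \<open>E\<close> to be the set of stars, after which
  only the EI condition has to be matched with \<open>omega_identity\<close>.\<close>

lemma finite_right_restriction_EI_Ehresmann_eq:
  "finite_right_restriction_EI_Ehresmann =
     {S. finite_algebra S \<and> Ehresmann_identities S \<and> right_ample_identity S \<and> omega_identity S}"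
  (is "_ = ?V")
proof -
  have EI: "EI_category (category_of S (star_op S ` carrier S)) \<longleftrightarrow> omega_identity S"
    if "finite_algebra S" "Ehresmann_identities S" "right_ample_identity S" for S :: "'a biunary"
  proof -
    interpret ehresmann_algebra S
      using that by unfold_locales (auto simp: finite_algebra_def)
    show ?thesis
      using that omega_identity_if_EI EI_if_omega_identity
      by (auto simp: finite_algebra_def projections_def)
  qed
  show ?thesis
    unfolding finite_right_restriction_EI_Ehresmann_def
    using EI by (auto simp: right_restriction_iff EI_Ehresmann_def Ehresmann_iff finite_algebra_def)
qed

section \<open>Closure properties\<close>

lemma hom_closed: "hom S T h \<Longrightarrow> a \<in> carrier S \<Longrightarrow> h a \<in> carrier T"
  and hom_mult: "hom S T h \<Longrightarrow> a \<in> carrier S \<Longrightarrow> b \<in> carrier S \<Longrightarrow>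
    h (a \<cdot>\<^bsub>S\<^esub> b) = h a \<cdot>\<^bsub>T\<^esub> h b"
  and hom_plus: "hom S T h \<Longrightarrow> a \<in> carrier S \<Longrightarrow> h (plus_op S a) = plus_op T (h a)"
  and hom_star: "hom S T h \<Longrightarrow> a \<in> carrier S \<Longrightarrow> h (star_op S a) = star_op T (h a)"
  by (auto simp: hom_def)

text \<open>The image of an idempotent power of \<open>x\<close> is an idempotent power of
  \<open>h x\<close>, so \<open>omega_eqI\<close> applies in \<open>T\<close>.\<close>

lemma hom_omega:
  assumes S: "biunary_semigroup S" "finite (carrier S)" and T: "biunary_semigroup T"
    and h: "hom S T h" and x: "x \<in> carrier S"
  shows "h (omega S x) = omega T (h x)"
proof -
  have carr: "\<And>n. spow S x n \<in> carrier S"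
    using S x by (simp add: biunary_semigroup_def spow_closed)
  have pow: "h (spow S x n) = spow T (h x) n" for n
    using h x carr by (induction n) (simp_all add: hom_mult)
  obtain n where n: "omega S x = spow S x n" "spow S x n \<cdot>\<^bsub>S\<^esub> spow S x n = spow S x n"
    using omega_spow[OF S x] .
  then have "spow T (h x) n \<cdot>\<^bsub>T\<^esub> spow T (h x) n = spow T (h x) n"
    using h carr by (metis hom_mult pow)
  then show ?thesis
    using omega_eqI[OF T hom_closed[OF h x]] n pow by simp
qed

definition variety_member :: "'a biunary \<Rightarrow> bool" where
  "variety_member S \<longleftrightarrow>
     finite_algebra S \<and> Ehresmann_identities S \<and> right_ample_identity S \<and> omega_identity S"

lemma variety_member_semigroup:
  "variety_member S \<Longrightarrow> biunary_semigroup S"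
  by (simp add: variety_member_def finite_algebra_def biunary_semigroup_def
      Ehresmann_identities_def)

text \<open>Covers both subalgebras (one homomorphism) and products (the projections).\<close>

lemma variety_member_if_separated:
  assumes S: "finite_algebra S"
    and T: "\<And>i. i \<in> I \<Longrightarrow> variety_member (T i)"
    and h: "\<And>i. i \<in> I \<Longrightarrow> hom S (T i) (h i)"
    and separated: "\<And>a b. a \<in> carrier S \<Longrightarrow> b \<in> carrier S \<Longrightarrow> (\<And>i. i \<in> I \<Longrightarrow> h i a = h i b) \<Longrightarrow> a = b"
  shows "variety_member S"
proof -
  have mult: "\<And>a b. a \<in> carrier S \<Longrightarrow> b \<in> carrier S \<Longrightarrow> a \<cdot>\<^bsub>S\<^esub> b \<in> carrier S"
    and plus: "\<And>a. a \<in> carrier S \<Longrightarrow> plus_op S a \<in> carrier S"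
    and star: "\<And>a. a \<in> carrier S \<Longrightarrow> star_op S a \<in> carrier S"
    using S by (auto simp: finite_algebra_def biunary_algebra_def)
  note simps = mult plus star hom_closed[OF h] hom_mult[OF h] hom_plus[OF h] hom_star[OF h]
  have TE: "ehresmann_algebra (T i)" if "i \<in> I" for i
    using T[OF that] by unfold_locales (auto simp: variety_member_def finite_algebra_def)
  have ident: "Ehresmann_identities S"
    unfolding Ehresmann_identities_def
    \<comment> \<open>Each identity is checked on its images in the \<open>T i\<close>. As
      left-to-right rules \<open>plus_mult\<close> and \<open>star_mult\<close> would loop, so a
      second pass uses them reversed.\<close>
    by (intro conjI ballI; rule separated)
       (simp_all add: simps TE[THEN ehresmann_algebra.assoc]
         TE[THEN ehresmann_algebra.plus_mult_self] TE[THEN ehresmann_algebra.plus_mult_plus]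
         TE[THEN ehresmann_algebra.mult_star_self] TE[THEN ehresmann_algebra.star_mult_star]
         TE[THEN ehresmann_algebra.star_plus] TE[THEN ehresmann_algebra.plus_star]
         TE[THEN ehresmann_algebra.plus_commute] TE[THEN ehresmann_algebra.star_commute],
        simp_all add: simps flip: TE[THEN ehresmann_algebra.plus_mult]
         TE[THEN ehresmann_algebra.star_mult])
  then have semi: "biunary_semigroup S"
    using S by (simp add: biunary_semigroup_def finite_algebra_def Ehresmann_identities_def)
  have fin: "finite (carrier S)"
    using S by (simp add: finite_algebra_def)
  have "right_ample_identity S"
    unfolding right_ample_identity_def
  proof (intro ballI, rule separated)
    fix a b i assume "a \<in> carrier S" "b \<in> carrier S" "i \<in> I"
    then show "h i (star_op S b \<cdot>\<^bsub>S\<^esub> a) = h i (a \<cdot>\<^bsub>S\<^esub> star_op S (star_op S b \<cdot>\<^bsub>S\<^esub> a))"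
      using T[of i] h[of i] unfolding variety_member_def right_ample_identity_def
      by (simp add: simps)
  qed (simp_all add: simps)
  moreover have "omega_identity S"
    unfolding omega_identity_def
  proof (intro ballI, rule separated)
    fix x i assume x: "x \<in> carrier S" and i: "i \<in> I"
    have "h i (omega S x) = omega (T i) (h i x)"
      using hom_omega[OF semi fin variety_member_semigroup[OF T[OF i]] h[OF i] x] .
    then show "h i (omega S x \<cdot>\<^bsub>S\<^esub> plus_op S (omega S x)) = h i (plus_op S (omega S x))"
      using T[OF i] omega_closed[OF semi fin x] hom_closed[OF h[OF i] x] i
      by (simp add: simps variety_member_def omega_identity_def)
  qed (simp_all add: omega_closed[OF semi fin] simps)
  ultimately show ?thesis
    using S ident by (simp add: variety_member_def)
qed

text \<open>Every element of \<open>T\<close> is an image, so the identities are pushed forward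
  along \<open>h\<close>.\<close>

lemma variety_member_homomorphic_image:
  assumes S: "variety_member S" and "homomorphic_image S T"
  shows "variety_member T"
proof -
  obtain h where h: "hom S T h" and onto: "carrier T = h ` carrier S"
    using assms(2) by (auto simp: homomorphic_image_def)
  interpret S: ehresmann_algebra S
    using S by unfold_locales (auto simp: variety_member_def finite_algebra_def)
  \<comment> \<open>Oriented to collect a term over \<open>T\<close> into the image of one element
    of \<open>S\<close>.\<close>
  note simps = hom_mult[OF h, symmetric] hom_plus[OF h, symmetric] hom_star[OF h, symmetric]
  have fin: "finite (carrier S)"
    using S by (simp add: variety_member_def finite_algebra_def)
  have T: "finite_algebra T"
    using S.algebra fin by (auto simp: finite_algebra_def biunary_algebra_def onto simps)
  have ident: "Ehresmann_identities T"
    unfolding Ehresmann_identities_def onto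
    by (intro conjI ballI; elim imageE)
       (simp_all add: simps S.assoc S.plus_mult_self S.plus_mult_plus S.mult_star_self
         S.star_mult_star S.star_plus S.plus_star S.plus_commute S.star_commute,
        simp_all flip: S.plus_mult S.star_mult)
  then have semi: "biunary_semigroup T"
    using T by (simp add: biunary_semigroup_def finite_algebra_def Ehresmann_identities_def)
  have "right_ample_identity T"
    unfolding right_ample_identity_def onto
  proof (intro ballI; elim imageE; hypsubst)
    fix a b assume ab: "a \<in> carrier S" "b \<in> carrier S"
    have "star_op T (h b) \<cdot>\<^bsub>T\<^esub> h a = h (star_op S b \<cdot>\<^bsub>S\<^esub> a)"
      using ab by (simp add: simps)
    also have "\<dots> = h (a \<cdot>\<^bsub>S\<^esub> star_op S (star_op S b \<cdot>\<^bsub>S\<^esub> a))"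
      using S ab by (metis right_ample_identity_def variety_member_def)
    also have "\<dots> = h a \<cdot>\<^bsub>T\<^esub> star_op T (star_op T (h b) \<cdot>\<^bsub>T\<^esub> h a)"
      using ab by (simp add: simps)
    finally show "star_op T (h b) \<cdot>\<^bsub>T\<^esub> h a = h a \<cdot>\<^bsub>T\<^esub> star_op T (star_op T (h b) \<cdot>\<^bsub>T\<^esub> h a)" .
  qed
  moreover have "omega_identity T"
    using S omega_closed[OF S.semigroup fin]
    by (simp add: omega_identity_def variety_member_def onto simps
        hom_omega[OF S.semigroup fin semi h, symmetric])
  ultimately show ?thesis
    using T ident by (simp add: variety_member_def)
qed

text \<open>The inclusion alone separates points, so a singleton serves as index set.\<close>

lemma variety_member_subalgebra:
  assumes S: "variety_member S" and T: "subalgebra T S"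
  shows "variety_member T"
proof (rule variety_member_if_separated)
  show "finite_algebra T"
    using assms by (auto simp: variety_member_def finite_algebra_def subalgebra_def
        intro: finite_subset)
  show "variety_member S" if "i \<in> {()}" for i by (fact S)
  show "hom T S (\<lambda>a. a)" if "i \<in> {()}" for i
    using T by (simp add: subalgebra_def)
qed simp

lemma hom_direct_product_proj:
  "i \<in> I \<Longrightarrow> hom (direct_product I F) (F i) (\<lambda>f. f i)"
  by (auto simp: hom_def direct_product_def)

lemma hom_compose: "hom S T g \<Longrightarrow> hom T U h \<Longrightarrow> hom S U (\<lambda>a. h (g a))"
  by (auto simp: hom_def Pi_iff)

text \<open>The isomorphism followed by the coordinate maps separates the points of
  \<open>P\<close>. For empty \<open>I\<close> this says that \<open>P\<close> is trivial.\<close>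

lemma variety_member_direct_product:
  assumes I: "finite I" and F: "\<And>i. i \<in> I \<Longrightarrow> variety_member (F i)"
    and P: "biunary_algebra P" and iso: "isomorphic P (direct_product I F)"
  shows "variety_member P"
proof -
  obtain h where h: "hom P (direct_product I F) h"
    and bij: "bij_betw h (carrier P) (\<Pi>\<^sub>E i\<in>I. carrier (F i))"
    using iso by (auto simp: isomorphic_def direct_product_def)
  have "finite (\<Pi>\<^sub>E i\<in>I. carrier (F i))"
    using I F by (intro finite_PiE) (auto simp: variety_member_def finite_algebra_def)
  then have "finite_algebra P"
    using P bij bij_betw_finite by (auto simp: finite_algebra_def)
  then show ?thesis
  proof (rule variety_member_if_separated[where I = I and T = F and h = "\<lambda>i a. h a i"])
    show "hom P (F i) (\<lambda>a. h a i)" if "i \<in> I" for i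
      using hom_compose[OF h hom_direct_product_proj[OF that]] .
    fix a b assume ab: "a \<in> carrier P" "b \<in> carrier P" "\<And>i. i \<in> I \<Longrightarrow> h a i = h b i"
    \<comment> \<open>Both functions are extensional, so agreement on \<open>I\<close> is
      enough.\<close>
    have "h a = h b"
      using ab bij by (intro PiE_ext[of "h a" I "\<lambda>i. carrier (F i)"]) (auto simp: bij_betw_def)
    then show "a = b"
      using ab bij by (auto simp: bij_betw_def inj_on_def)
  qed (fact F)
qed

theorem corollary3p10:
  "pseudovariety (finite_right_restriction_EI_Ehresmann :: 'a biunary set) \<and>
   (finite_right_restriction_EI_Ehresmann :: 'a biunary set) =
     {S. finite_algebra S \<and> Ehresmann_identities S \<and> right_ample_identity S \<and> omega_identity S}"
proof
  have V: "(finite_right_restriction_EI_Ehresmann :: 'a biunary set) = Collect variety_member"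
    by (simp add: finite_right_restriction_EI_Ehresmann_eq flip: variety_member_def)
  show "pseudovariety (finite_right_restriction_EI_Ehresmann :: 'a biunary set)"
    unfolding V pseudovariety_def mem_Collect_eq
  proof (intro conjI)
    show "\<forall>S\<in>Collect variety_member. finite_algebra (S :: 'a biunary)"
      by (simp add: variety_member_def)
    show "\<forall>S\<in>Collect variety_member. \<forall>T :: 'a biunary. subalgebra T S \<longrightarrow> variety_member T"
      by (simp add: variety_member_subalgebra)
    show "\<forall>S\<in>Collect variety_member. \<forall>T :: 'a biunary. homomorphic_image S T \<longrightarrow> variety_member T"
      by (intro ballI allI impI) (rule variety_member_homomorphic_image, simp_all)
    show "\<forall>(n :: nat) (F :: nat \<Rightarrow> 'a biunary). \<forall>P :: 'a biunary.
        (\<forall>i<n. variety_member (F i)) \<longrightarrow> biunary_algebra P \<longrightarrow>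
        isomorphic P (direct_product {..<n} F) \<longrightarrow> variety_member P"
    proof (intro allI impI)
      fix n :: nat and F :: "nat \<Rightarrow> 'a biunary" and P :: "'a biunary"
      assume "\<forall>i<n. variety_member (F i)" and P: "biunary_algebra P"
        "isomorphic P (direct_product {..<n} F)"
      then have "\<And>i. i \<in> {..<n} \<Longrightarrow> variety_member (F i)" by simp
      from finite_lessThan this P show "variety_member P"
        by (rule variety_member_direct_product)
    qed
  qed
qed (rule finite_right_restriction_EI_Ehresmann_eq)

end
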